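(* Let $(R,v)$ be a complete, positively filtered ring, and suppose that $(\sigma,\delta)$ is a skew derivation on $R$ compatible with $v$. Fix $a\in R^\times$ and $t\in R$. (i) If $v(a)=v(a^{-1})=0$, then $R[[x;\sigma,\delta]]=R[[ax;\mathbf{c}_a\sigma,a\delta]]$ as filtered rings. (ii) If $v(t)\ge 1$, then $R[[x;\sigma,\delta]]=R[[x-t;\sigma,\delta-\mathbf{d}_{\sigma,t}]]$ as filtered rings.
   Context: A filtration on a ring $R$ is a function $v:R\to\mathbb{Z}\cup\{\infty\}$ with $v(1)=0$, $v(r+s)\ge\min\{v(r),v(s)\}$, $v(rs)\ge v(r)+v(s)$, and $v(r)=\infty$ iff $r=0$; it is positive if its values lie in $\mathbb{N}\cup\{\infty\}$. A skew derivation $(\sigma,\delta)$ on $R$ consists of an automorphism $\sigma$ and an additive map $\delta:R\to R$ with $\delta(rs)=\delta(r)s+\sigma(r)\delta(s)$. It is compatible with $v$ if $v(\sigma(r))=v(r)$ and $v(\delta(r))>v(r)$ for all $0\ne r\in R$. If $(R,v)$ is complete and positively filtered and $(\sigma,\delta)$ is compatible, the skew power series ring $R[[x;\sigma,\delta]]$ is the set of formal series $\sum_{i\ge0}r_ix^i$ ($r_i\in R$) with its left $R$-module structure and the (well-defined, continuous, associative) multiplication determined by $xr=\sigma(r)x+\delta(r)$; it carries the complete positive filtration $f_{v,x}(\sum r_ix^i)=\inf_i\{v(r_i)+i\}$. For $a\in R^\times$, $\mathbf{c}_a(r)=ara^{-1}$; for $t\in R$, $\mathbf{d}_{\sigma,t}(r)=tr-\sigma(r)t$;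 $a\delta$ is the map $r\mapsto a\delta(r)$. "$R[[x;\sigma,\delta]]=R[[y;\sigma',\delta']]$ as filtered rings", for an element $y\in R[[x;\sigma,\delta]]$, means: $(\sigma',\delta')$ is a compatible skew derivation on $R$, $yr=\sigma'(r)y+\delta'(r)$ for all $r\in R$, every element of $R[[x;\sigma,\delta]]$ is uniquely a convergent sum $\sum_{i\ge 0}r_iy^i$ with $r_i\in R$ (every such sum converging), so that the two are equal as rings, and the standard filtrations agree: $f_{v,x}=f_{v,y}$, where $f_{v,y}(\sum r_iy^i)=\inf_i\{v(r_i)+i\}$. *)

theory Defs
  imports "HOL-Computational_Algebra.Formal_Power_Series" "HOL-Library.Extended_Nat"
begin

text \<open>A positive filtration takes its values in the natural numbers together with infinity,
  so it is a function into \<^typ>\<open>enat\<close>.\<close>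

definition positive_filtration :: "('a::ring_1 \<Rightarrow> enat) \<Rightarrow> bool" where
  "positive_filtration v \<longleftrightarrow>
     v 1 = 0 \<and>
     (\<forall>r s. v (r + s) \<ge> min (v r) (v s)) \<and>
     (\<forall>r s. v (r * s) \<ge> v r + v s) \<and>
     (\<forall>r. v r = \<infinity> \<longleftrightarrow> r = 0)"

definition filt_tendsto :: "('b::ab_group_add \<Rightarrow> enat) \<Rightarrow> (nat \<Rightarrow> 'b) \<Rightarrow> 'b \<Rightarrow> bool" where
  "filt_tendsto w s l \<longleftrightarrow> (\<forall>N::nat. \<exists>M. \<forall>n\<ge>M. w (s n - l) \<ge> enat N)"

definition filt_Cauchy :: "('b::ab_group_add \<Rightarrow> enat) \<Rightarrow> (nat \<Rightarrow> 'b) \<Rightarrow> bool" where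
  "filt_Cauchy w s \<longleftrightarrow> (\<forall>N::nat. \<exists>M. \<forall>m\<ge>M. \<forall>n\<ge>M. w (s m - s n) \<ge> enat N)"

definition filt_complete :: "('b::ab_group_add \<Rightarrow> enat) \<Rightarrow> bool" where
  "filt_complete w \<longleftrightarrow> (\<forall>s. filt_Cauchy w s \<longrightarrow> (\<exists>l. filt_tendsto w s l))"

definition filt_sums :: "('b::ab_group_add \<Rightarrow> enat) \<Rightarrow> (nat \<Rightarrow> 'b) \<Rightarrow> 'b \<Rightarrow> bool" where
  "filt_sums w f l \<longleftrightarrow> filt_tendsto w (\<lambda>n. \<Sum>i<n. f i) l"

definition filt_suminf :: "('b::ab_group_add \<Rightarrow> enat) \<Rightarrow> (nat \<Rightarrow> 'b) \<Rightarrow> 'b" where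
  "filt_suminf w f = (THE l. filt_sums w f l)"

definition ring_automorphism :: "('a::ring_1 \<Rightarrow> 'a) \<Rightarrow> bool" where
  "ring_automorphism \<sigma> \<longleftrightarrow>
     bij \<sigma> \<and> \<sigma> 1 = 1 \<and> (\<forall>r s. \<sigma> (r + s) = \<sigma> r + \<sigma> s) \<and> (\<forall>r s. \<sigma> (r * s) = \<sigma> r * \<sigma> s)"

definition skew_derivation :: "('a::ring_1 \<Rightarrow> 'a) \<Rightarrow> ('a \<Rightarrow> 'a) \<Rightarrow> bool" where
  "skew_derivation \<sigma> \<delta> \<longleftrightarrow>
     ring_automorphism \<sigma> \<and>
     (\<forall>r s. \<delta> (r + s) = \<delta> r + \<delta> s) \<and>
     (\<forall>r s. \<delta> (r * s) = \<delta> r * s + \<sigma> r * \<delta> s)"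

definition compatible :: "('a::ring_1 \<Rightarrow> enat) \<Rightarrow> ('a \<Rightarrow> 'a) \<Rightarrow> ('a \<Rightarrow> 'a) \<Rightarrow> bool" where
  "compatible v \<sigma> \<delta> \<longleftrightarrow> (\<forall>r. r \<noteq> 0 \<longrightarrow> v (\<sigma> r) = v r \<and> v (\<delta> r) > v r)"

text \<open>The elements of the skew power series ring are the formal series, i.e. the type
  \<^typ>\<open>'a fps\<close> with coefficients written on the left of the powers of the variable.  Addition
  is that of \<^typ>\<open>'a fps\<close>; the library multiplication of \<^typ>\<open>'a fps\<close>, in which the variable
  is central, is not the ring multiplication; the two agree for constant left factors.

  \<open>skew_coeff \<sigma> \<delta> n k r\<close> is the coefficient of $x^k$ in $x^n r$, obtained by applying
  $x s = \sigma(s) x + \delta(s)$ to the coefficients $s$ of $x^{n-1} r$.\<close>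

fun skew_coeff :: "('a::ring_1 \<Rightarrow> 'a) \<Rightarrow> ('a \<Rightarrow> 'a) \<Rightarrow> nat \<Rightarrow> nat \<Rightarrow> 'a \<Rightarrow> 'a" where
  "skew_coeff \<sigma> \<delta> 0 k r = (if k = 0 then r else 0)"
| "skew_coeff \<sigma> \<delta> (Suc n) k r =
     (if k = 0 then 0 else \<sigma> (skew_coeff \<sigma> \<delta> n (k - 1) r)) + \<delta> (skew_coeff \<sigma> \<delta> n k r)"

text \<open>The product is $\sum_{i,j} p_i (x^i q_j) x^j$.  Its coefficient at $x^n$ is an infinite sum
  over $i$, which converges in a complete ring when the skew derivation is compatible, since
  then \<open>v (skew_coeff \<sigma> \<delta> i k r) \<ge> i - k\<close>.\<close>

definition skew_mult ::
  "('a::ring_1 \<Rightarrow> enat) \<Rightarrow> ('a \<Rightarrow> 'a) \<Rightarrow> ('a \<Rightarrow> 'a) \<Rightarrow> 'a fps \<Rightarrow> 'a fps \<Rightarrow> 'a fps" where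
  "skew_mult v \<sigma> \<delta> p q =
     Abs_fps (\<lambda>n. filt_suminf v
       (\<lambda>i. \<Sum>j\<le>n. fps_nth p i * skew_coeff \<sigma> \<delta> i (n - j) (fps_nth q j)))"

text \<open>The product is left linear over the base ring and satisfies $x r = \sigma(r) x + \delta(r)$.\<close>

lemma filt_suminf_eqI:
  assumes v: "positive_filtration v" and z: "\<And>i. i \<ge> m \<Longrightarrow> f i = 0"
  shows "filt_suminf v f = (\<Sum>i<m. f i)"
  unfolding filt_suminf_def
proof (rule the_equality)
  have v0: "v 0 = \<infinity>" using v by (simp add: positive_filtration_def)
  have eq: "(\<Sum>i<n. f i) = (\<Sum>i<m. f i)" if "n \<ge> m" for n
    using that z by (intro sum.mono_neutral_right) auto
  show "filt_sums v f (\<Sum>i<m. f i)"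
    unfolding filt_sums_def filt_tendsto_def
  proof (intro allI exI[of _ m] impI)
    fix N n assume "n \<ge> m"
    then show "v ((\<Sum>i<n. f i) - (\<Sum>i<m. f i)) \<ge> enat N" by (simp only: eq[of n]) (simp add: v0)
  qed
  fix l assume l: "filt_sums v f l"
  have "v ((\<Sum>i<m. f i) - l) \<ge> enat N" for N
  proof -
    obtain M where "\<forall>n\<ge>M. v ((\<Sum>i<n. f i) - l) \<ge> enat N"
      using l unfolding filt_sums_def filt_tendsto_def by blast
    then have "v ((\<Sum>i<max M m. f i) - l) \<ge> enat N" by simp
    then show ?thesis using eq[of "max M m"] by simp
  qed
  then have le: "enat N \<le> v ((\<Sum>i<m. f i) - l)" for N .
  have "v ((\<Sum>i<m. f i) - l) = \<infinity>"
  proof (cases "v ((\<Sum>i<m. f i) - l)")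
    case (enat k)
    then show ?thesis using le[of "Suc k"] by simp
  qed
  then show "l = (\<Sum>i<m. f i)" using v by (simp add: positive_filtration_def)
qed

lemma skew_mult_const_left:
  assumes "positive_filtration v"
  shows "skew_mult v \<sigma> \<delta> (fps_const r) p = fps_const r * p"
proof (rule fps_ext)
  fix n
  have "filt_suminf v (\<lambda>i. \<Sum>j\<le>n. fps_nth (fps_const r) i * skew_coeff \<sigma> \<delta> i (n - j) (fps_nth p j))
      = (\<Sum>i<1. \<Sum>j\<le>n. fps_nth (fps_const r) i * skew_coeff \<sigma> \<delta> i (n - j) (fps_nth p j))"
    by (rule filt_suminf_eqI[OF assms]) auto
  also have "\<dots> = (\<Sum>j\<le>n. if j = n then r * fps_nth p j else 0)"
    by (simp add: sum_distrib_left[symmetric])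
  also have "\<dots> = r * fps_nth p n" by simp
  finally show "fps_nth (skew_mult v \<sigma> \<delta> (fps_const r) p) n = fps_nth (fps_const r * p) n"
    by (simp add: skew_mult_def)
qed

lemma skew_mult_X_const:
  assumes v: "positive_filtration v" and d: "skew_derivation \<sigma> \<delta>"
  shows "skew_mult v \<sigma> \<delta> fps_X (fps_const r) =
           skew_mult v \<sigma> \<delta> (fps_const (\<sigma> r)) fps_X + fps_const (\<delta> r)"
proof (rule fps_ext)
  fix n
  have "\<sigma> (0 + 0) = \<sigma> 0 + \<sigma> 0" "\<delta> (0 + 0) = \<delta> 0 + \<delta> 0"
    using d unfolding skew_derivation_def ring_automorphism_def by blast+
  then have z: "\<sigma> 0 = 0" "\<delta> 0 = 0"
    by simp_all
  have s0: "skew_coeff \<sigma> \<delta> i k 0 = 0" for i k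
    by (induction i arbitrary: k) (auto simp: z)
  have "filt_suminf v (\<lambda>i. \<Sum>j\<le>n. fps_nth fps_X i * skew_coeff \<sigma> \<delta> i (n - j) (fps_nth (fps_const r) j))
      = (\<Sum>i<2. \<Sum>j\<le>n. fps_nth fps_X i * skew_coeff \<sigma> \<delta> i (n - j) (fps_nth (fps_const r) j))"
    by (rule filt_suminf_eqI[OF v]) auto
  also have "\<dots> = (\<Sum>j\<le>n. skew_coeff \<sigma> \<delta> 1 (n - j) (fps_nth (fps_const r) j))"
    by (simp add: numeral_2_eq_2)
  also have "\<dots> = (\<Sum>j\<le>n. if j = 0 then skew_coeff \<sigma> \<delta> 1 n r else 0)"
    by (intro sum.cong) (auto simp: s0 simp del: skew_coeff.simps)
  also have "\<dots> = skew_coeff \<sigma> \<delta> 1 n r" by simp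
  also have "\<dots> = fps_nth (fps_const (\<sigma> r) * fps_X + fps_const (\<delta> r)) n"
    by (cases n) (simp_all add: z)
  finally show "fps_nth (skew_mult v \<sigma> \<delta> fps_X (fps_const r)) n =
      fps_nth (skew_mult v \<sigma> \<delta> (fps_const (\<sigma> r)) fps_X + fps_const (\<delta> r)) n"
    by (simp only: skew_mult_const_left[OF v]) (simp only: skew_mult_def fps_nth_Abs_fps)
qed

primrec skew_power ::
  "('a::ring_1 \<Rightarrow> enat) \<Rightarrow> ('a \<Rightarrow> 'a) \<Rightarrow> ('a \<Rightarrow> 'a) \<Rightarrow> 'a fps \<Rightarrow> nat \<Rightarrow> 'a fps" where
  "skew_power v \<sigma> \<delta> y 0 = 1"
| "skew_power v \<sigma> \<delta> y (Suc n) = skew_mult v \<sigma> \<delta> y (skew_power v \<sigma> \<delta> y n)"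

text \<open>The standard filtration, as a function of the coefficient sequence: applied to the
  coefficients with respect to $x$ it is $f_{v,x}$, applied to those with respect to $y$ it
  is $f_{v,y}$.\<close>

definition series_filtration :: "('a::ring_1 \<Rightarrow> enat) \<Rightarrow> 'a fps \<Rightarrow> enat" where
  "series_filtration v p = (INF i. v (fps_nth p i) + enat i)"

text \<open>\<open>skew_expansion v \<sigma> \<delta> y c p\<close>: in $R[[x;\sigma,\delta]]$ the series $\sum_i c_i y^i$
  converges to \<open>p\<close>.  Here \<open>c\<close> merely collects the coefficients $c_i$.\<close>

definition skew_expansion ::
  "('a::ring_1 \<Rightarrow> enat) \<Rightarrow> ('a \<Rightarrow> 'a) \<Rightarrow> ('a \<Rightarrow> 'a) \<Rightarrow> 'a fps \<Rightarrow> 'a fps \<Rightarrow> 'a fps \<Rightarrow> bool" where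
  "skew_expansion v \<sigma> \<delta> y c p \<longleftrightarrow>
     filt_sums (series_filtration v)
       (\<lambda>i. skew_mult v \<sigma> \<delta> (fps_const (fps_nth c i)) (skew_power v \<sigma> \<delta> y i)) p"

text \<open>$R[[x;\sigma,\delta]] = R[[y;\sigma',\delta']]$ as filtered rings.  The fifth to seventh
  conjuncts spell out equality as rings: identifying a formal series in $y$ with its sum
  in $R[[x;\sigma,\delta]]$, the ring operations of both sides coincide.\<close>

definition skew_series_filtered_eq ::
  "('a::ring_1 \<Rightarrow> enat) \<Rightarrow> ('a \<Rightarrow> 'a) \<Rightarrow> ('a \<Rightarrow> 'a) \<Rightarrow>
   'a fps \<Rightarrow> ('a \<Rightarrow> 'a) \<Rightarrow> ('a \<Rightarrow> 'a) \<Rightarrow> bool" where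
  "skew_series_filtered_eq v \<sigma> \<delta> y \<sigma>' \<delta>' \<longleftrightarrow>
     (skew_derivation \<sigma>' \<delta>' \<and> compatible v \<sigma>' \<delta>') \<and>
     (\<forall>r. skew_mult v \<sigma> \<delta> y (fps_const r) =
            skew_mult v \<sigma> \<delta> (fps_const (\<sigma>' r)) y + fps_const (\<delta>' r)) \<and>
     (\<forall>c. \<exists>p. skew_expansion v \<sigma> \<delta> y c p) \<and>
     (\<forall>p. \<exists>!c. skew_expansion v \<sigma> \<delta> y c p) \<and>
     skew_expansion v \<sigma> \<delta> y 1 1 \<and>
     (\<forall>c d p q. skew_expansion v \<sigma> \<delta> y c p \<longrightarrow> skew_expansion v \<sigma> \<delta> y d q \<longrightarrow>
            skew_expansion v \<sigma> \<delta> y (c + d) (p + q)) \<and>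
     (\<forall>c d p q. skew_expansion v \<sigma> \<delta> y c p \<longrightarrow> skew_expansion v \<sigma> \<delta> y d q \<longrightarrow>
            skew_expansion v \<sigma> \<delta> y (skew_mult v \<sigma>' \<delta>' c d) (skew_mult v \<sigma> \<delta> p q)) \<and>
     (\<forall>c p. skew_expansion v \<sigma> \<delta> y c p \<longrightarrow> series_filtration v p = series_filtration v c)"

definition inner_skew_derivation :: "('a::ring_1 \<Rightarrow> 'a) \<Rightarrow> 'a \<Rightarrow> 'a \<Rightarrow> 'a" where
  "inner_skew_derivation \<sigma> t r = t * r - \<sigma> r * t"

text \<open>Conjugation by a unit \<open>a\<close>, whose inverse \<open>a'\<close> is passed explicitly.\<close>

definition conj_by :: "'a::ring_1 \<Rightarrow> 'a \<Rightarrow> 'a \<Rightarrow> 'a" where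
  "conj_by a a' r = a * r * a'"

end

theory Submission
  imports Defs
begin

text \<open>Let $Y$ be an additive operator on the complete group of formal series that raises the
  filtration by at least one and satisfies $Y(rm) = \sigma'(r)\,Y(m) + \delta'(r)\,m$.  Then
  $c \cdot m = \sum_i c_i Y^i(m)$ makes the series group a module over
  $R[[y;\sigma',\delta']]$.  When $Y$ is left multiplication by $x$, the module law is
  associativity of $R[[x;\sigma,\delta]]$.  When $Y$ is left multiplication by an element $y$ with
  $yr = \sigma'(r)y + \delta'(r)$, it says that $c \mapsto \sum_i c_i y^i$ is multiplicative;
  this map also does not decrease the filtration.  For $y = ax$ and $y = x - t$ the same
  construction with $a^{-1}$ and $-t$ gives the inverse map, so the map is a bijection that
  preserves the filtration.\<close>


section \<open>Filtered groups\<close>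

text \<open>Serves both \<open>v\<close> on the base ring and \<open>series_filtration v\<close> on
  series. With the ultrametric inequality stated for differences, invariance under negation
  follows.\<close>

locale filtered_group =
  fixes w :: "'b::ab_group_add \<Rightarrow> enat"
  assumes filt_diff: "min (w x) (w y) \<le> w (x - y)"
    and filt_eq_infinity_iff: "w x = \<infinity> \<longleftrightarrow> x = 0"
begin

lemma filt_zero [simp]: "w 0 = \<infinity>"
  by (simp add: filt_eq_infinity_iff)

lemma filt_minus [simp]: "w (- x) = w x"
  using filt_diff[of 0 x] filt_diff[of 0 "- x"] by simp

lemma filt_add: "min (w x) (w y) \<le> w (x + y)"
  using filt_diff[of x "- y"] by simp

lemma filt_add_ge: "K \<le> w x \<Longrightarrow> K \<le> w y \<Longrightarrow> K \<le> w (x + y)"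
  using filt_add[of x y] by (meson min.bounded_iff order_trans)

lemma filt_diff_ge: "K \<le> w x \<Longrightarrow> K \<le> w y \<Longrightarrow> K \<le> w (x - y)"
  using filt_diff[of x y] by (meson min.bounded_iff order_trans)

lemma filt_diff_commute: "w (x - y) = w (y - x)"
  using filt_minus[of "x - y"] by simp

lemma filt_sum_ge: "(\<And>i. i \<in> A \<Longrightarrow> K \<le> w (f i)) \<Longrightarrow> K \<le> w (sum f A)"
  by (induction A rule: infinite_finite_induct) (auto intro: filt_add_ge)

lemma filt_eq_zeroI:
  assumes "\<And>N. enat N \<le> w x"
  shows "x = 0"
proof -
  have "w x = \<infinity>"
  proof (cases "w x")
    case (enat k)
    then show ?thesis using assms[of "Suc k"] by simp
  qed
  then show ?thesis by (simp add: filt_eq_infinity_iff)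
qed

lemma filt_tendsto_unique:
  assumes "filt_tendsto w s l" and "filt_tendsto w s l'"
  shows "l = l'"
proof -
  have "enat N \<le> w (l - l')" for N
  proof -
    obtain M M' where "\<forall>n\<ge>M. enat N \<le> w (s n - l)" "\<forall>n\<ge>M'. enat N \<le> w (s n - l')"
      using assms unfolding filt_tendsto_def by meson
    then have "enat N \<le> w (s (max M M') - l')" "enat N \<le> w (s (max M M') - l)"
      by simp_all
    from filt_diff_ge[OF this] show ?thesis by simp
  qed
  then show ?thesis using filt_eq_zeroI[of "l - l'"] by simp
qed

lemma filt_sums_unique: "filt_sums w f l \<Longrightarrow> filt_sums w f l' \<Longrightarrow> l = l'"
  unfolding filt_sums_def by (rule filt_tendsto_unique)

lemma filt_suminf_eq: "filt_sums w f l \<Longrightarrow> filt_suminf w f = l"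
  unfolding filt_suminf_def by (blast intro: filt_sums_unique)

text \<open>Otherwise \<open>w l\<close> is finite and below \<open>K\<close>. For large
  \<open>M\<close> the value of \<open>s M - l\<close> exceeds \<open>w l\<close>, so both parts of
  \<open>l = s M - (s M - l)\<close> have value above \<open>w l\<close>, which is absurd.\<close>

lemma filt_tendsto_ge:
  assumes "filt_tendsto w s l" and "\<And>n. K \<le> w (s n)"
  shows "K \<le> w l"
proof (rule ccontr)
  assume "\<not> K \<le> w l"
  then have less: "w l < K" by simp
  then obtain k where k: "w l = enat k" by (cases "w l") auto
  obtain M where "\<forall>n\<ge>M. enat (Suc k) \<le> w (s n - l)"
    using assms(1) unfolding filt_tendsto_def by blast
  then have "enat (Suc k) \<le> w (s M - l)" by simp
  then have "min K (enat (Suc k)) \<le> w (s M - (s M - l))"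
    using assms(2)[of M] filt_diff_ge[of "min K (enat (Suc k))" "s M" "s M - l"] by (auto simp: min_le_iff_disj)
  then have "min K (enat (Suc k)) \<le> enat k" by (simp add: k)
  then show False using less[unfolded k] by (simp add: min_le_iff_disj)
qed

lemma filt_sums_ge:
  assumes "filt_sums w f l" and "\<And>i. K \<le> w (f i)"
  shows "K \<le> w l"
  using assms unfolding filt_sums_def by (elim filt_tendsto_ge) (rule filt_sum_ge)

lemma filt_sums_add:
  assumes "filt_sums w f l" and "filt_sums w g m"
  shows "filt_sums w (\<lambda>i. f i + g i) (l + m)"
  unfolding filt_sums_def filt_tendsto_def
proof
  fix N
  obtain M M' where M: "\<forall>n\<ge>M. enat N \<le> w (sum f {..<n} - l)"
    and M': "\<forall>n\<ge>M'. enat N \<le> w (sum g {..<n} - m)"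
    using assms unfolding filt_sums_def filt_tendsto_def by meson
  have "enat N \<le> w ((\<Sum>i<n. f i + g i) - (l + m))" if "n \<ge> max M M'" for n
  proof -
    have "enat N \<le> w ((sum f {..<n} - l) + (sum g {..<n} - m))"
      using M M' that by (intro filt_add_ge) auto
    then show ?thesis by (simp add: sum.distrib algebra_simps)
  qed
  then show "\<exists>M. \<forall>n\<ge>M. enat N \<le> w ((\<Sum>i<n. f i + g i) - (l + m))" by blast
qed

text \<open>Reindexing for the moment when an extra factor \<open>Y\<close> turns the term of index
  \<open>j\<close> into one with the power \<open>Suc j\<close>.\<close>

lemma filt_sums_shift:
  assumes "filt_sums w f l"
  shows "filt_sums w (\<lambda>i. case i of 0 \<Rightarrow> 0 | Suc j \<Rightarrow> f j) l"
  unfolding filt_sums_def filt_tendsto_def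
proof
  fix N
  obtain M where M: "\<forall>n\<ge>M. enat N \<le> w (sum f {..<n} - l)"
    using assms unfolding filt_sums_def filt_tendsto_def by blast
  have "enat N \<le> w ((\<Sum>i<n. case i of 0 \<Rightarrow> 0 | Suc j \<Rightarrow> f j) - l)" if "n \<ge> Suc M" for n
  proof -
    from that obtain k where "n = Suc k" "k \<ge> M" by (cases n) auto
    then show ?thesis using M by (simp add: sum.lessThan_Suc_shift del: sum.lessThan_Suc)
  qed
  then show "\<exists>M. \<forall>n\<ge>M. enat N \<le> w ((\<Sum>i<n. case i of 0 \<Rightarrow> 0 | Suc j \<Rightarrow> f j) - l)" by blast
qed

lemma filt_sums_finite:
  assumes "\<And>i. i \<ge> m \<Longrightarrow> g i = 0"
  shows "filt_sums w g (sum g {..<m})"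
proof -
  have "sum g {..<n} = sum g {..<m}" if "n \<ge> m" for n
    using that assms by (intro sum.mono_neutral_right) auto
  then show ?thesis
    unfolding filt_sums_def filt_tendsto_def by (metis diff_self filt_zero enat_ord_code(3))
qed

text \<open>A finite block of terms with indices at least \<open>N\<close> has value at least
  \<open>N\<close>, so the partial sums are Cauchy.\<close>

lemma filt_summable:
  assumes "filt_complete w" and "\<And>i. enat i \<le> w (f i)"
  shows "\<exists>l. filt_sums w f l"
proof -
  have le: "enat N \<le> w (sum f {..<m} - sum f {..<n})" if "N \<le> n" "n \<le> m" for N m n
  proof -
    have "sum f {..<m} - sum f {..<n} = sum f {n..<m}"
      using that sum_diff_nat_ivl[of 0 n m f] by (simp add: lessThan_atLeast0)
    moreover have "enat N \<le> w (f i)" if "i \<in> {n..<m}" for i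
      using assms(2)[of i] that \<open>N \<le> n\<close> by (auto intro: order_trans[of _ "enat i"])
    ultimately show ?thesis by (auto intro: filt_sum_ge)
  qed
  have "enat N \<le> w (sum f {..<m} - sum f {..<n})" if "N \<le> n" "N \<le> m" for N m n
    using le[of N n m] le[of N m n] that by (cases "n \<le> m") (auto simp: filt_diff_commute)
  then have "filt_Cauchy w (\<lambda>n. sum f {..<n})"
    unfolding filt_Cauchy_def by blast
  then show ?thesis
    using assms(1) unfolding filt_complete_def filt_sums_def by blast
qed

end

text \<open>An additive map that lowers the filtration by at most \<open>k\<close> is continuous.
  Reading off the coefficient of index \<open>n\<close> uses \<open>k = n\<close>; multiplications
  and evaluations use \<open>k = 0\<close>.\<close>

lemma filt_sums_image:
  assumes "additive T" and bound: "\<And>x. w x \<le> w' (T x) + enat k" and "filt_sums w f l"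
  shows "filt_sums w' (\<lambda>i. T (f i)) (T l)"
  unfolding filt_sums_def filt_tendsto_def
proof
  interpret additive T by fact
  fix N
  obtain M where M: "\<forall>n\<ge>M. enat (N + k) \<le> w (sum f {..<n} - l)"
    using assms(3) unfolding filt_sums_def filt_tendsto_def by blast
  have "enat N \<le> w' ((\<Sum>i<n. T (f i)) - T l)" if "n \<ge> M" for n
  proof -
    have "enat (N + k) \<le> w' (T (sum f {..<n} - l)) + enat k"
      using M that bound order_trans by blast
    then have "enat N \<le> w' (T (sum f {..<n} - l))"
      by (cases "w' (T (sum f {..<n} - l))") auto
    then show ?thesis by (simp add: diff sum)
  qed
  then show "\<exists>M. \<forall>n\<ge>M. enat N \<le> w' ((\<Sum>i<n. T (f i)) - T l)" by blast
qed

section \<open>The filtration on series\<close>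

locale complete_filtered_ring =
  fixes v :: "'a::ring_1 \<Rightarrow> enat"
  assumes positive_filtration: "positive_filtration v" and complete: "filt_complete v"
begin

abbreviation f where "f \<equiv> series_filtration v"

lemma filt_one: "v 1 = 0" and filt_mult: "v r + v s \<le> v (r * s)"
  using positive_filtration unfolding positive_filtration_def by blast+

sublocale filtered_group v
proof
  \<comment> \<open>From \<open>(- 1) * (- 1) = 1\<close> one gets
    \<open>v (- 1) + v (- 1) \<le> v 1 = 0\<close>.\<close>
  have minus_one: "v (- 1) = 0"
    using filt_mult[of "- 1" "- 1"] filt_one by simp
  then have neg: "v x \<le> v (- x)" for x
    using filt_mult[of "- 1" x] by simp
  fix x y
  have "min (v x) (v (- y)) \<le> v (x + - y)"
    using positive_filtration unfolding positive_filtration_def by blast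
  then show "min (v x) (v y) \<le> v (x - y)"
    using neg[of y] by (auto simp: min_le_iff_disj intro: order_trans)
  show "v x = \<infinity> \<longleftrightarrow> x = 0"
    using positive_filtration unfolding positive_filtration_def by simp
qed

lemma series_filtration_ge_iff: "K \<le> f p \<longleftrightarrow> (\<forall>i. K \<le> v (fps_nth p i) + enat i)"
  unfolding series_filtration_def by (simp add: le_INF_iff)

lemma series_filtration_le: "f p \<le> v (fps_nth p i) + enat i"
  using series_filtration_ge_iff by blast

sublocale series: filtered_group f
proof
  fix p q :: "'a fps"
  have "min (f p) (f q) \<le> v (fps_nth (p - q) i) + enat i" for i
  proof -
    have "min (f p) (f q) \<le> min (v (fps_nth p i)) (v (fps_nth q i)) + enat i"
      using series_filtration_le[of p i] series_filtration_le[of q i]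
      by (auto simp: min_def intro: order_trans)
    also have "\<dots> \<le> v (fps_nth (p - q) i) + enat i"
      using filt_diff by (simp add: add_right_mono)
    finally show ?thesis .
  qed
  then show "min (f p) (f q) \<le> f (p - q)" by (simp add: series_filtration_ge_iff)
  have "fps_nth p i = 0" if "f p = \<infinity>" for i
    using series_filtration_le[of p i] that by (cases "v (fps_nth p i)") (auto simp: filt_eq_infinity_iff)
  moreover have "f 0 = \<infinity>"
    using series_filtration_ge_iff[of \<infinity> 0] by simp
  ultimately show "f p = \<infinity> \<longleftrightarrow> p = 0"
    by (auto intro: fps_ext)
qed

lemma series_filtration_one [simp]: "f 1 = 0"
  using series_filtration_le[of 1 0] by (simp add: filt_one zero_enat_def[symmetric])

lemma series_filtration_const_mult: "v r + f p \<le> f (fps_const r * p)"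
proof -
  have "v r + f p \<le> v (fps_nth (fps_const r * p) i) + enat i" for i
  proof -
    have "v r + f p \<le> v r + (v (fps_nth p i) + enat i)"
      by (intro add_left_mono series_filtration_le)
    also have "\<dots> \<le> v (r * fps_nth p i) + enat i"
      by (metis add.assoc add_right_mono filt_mult)
    finally show ?thesis by simp
  qed
  then show ?thesis by (simp add: series_filtration_ge_iff)
qed

lemma series_filtration_const_mult': "f p \<le> f (fps_const r * p) + enat 0"
  using order_trans[OF add_increasing[OF zero_le order_refl] series_filtration_const_mult]
  by (simp add: zero_enat_def[symmetric])

text \<open>The limit is formed coefficient by coefficient; the point is that convergence is uniform
  in the index.\<close>

lemma filt_complete_series: "filt_complete f"
  unfolding filt_complete_def
proof (intro allI impI)
  fix s assume s: "filt_Cauchy f s"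
  have "\<exists>l. filt_tendsto v (\<lambda>n. fps_nth (s n) i) l" for i
  proof -
    have "\<exists>M. \<forall>m\<ge>M. \<forall>n\<ge>M. enat N \<le> v (fps_nth (s m) i - fps_nth (s n) i)" for N
    proof -
      \<comment> \<open>The weight \<open>i\<close> of this coefficient in \<open>f\<close> is lost
        on passing to \<open>v\<close>, hence the precision \<open>N + i\<close>.\<close>
      obtain M where M: "\<forall>m\<ge>M. \<forall>n\<ge>M. enat (N + i) \<le> f (s m - s n)"
        using s unfolding filt_Cauchy_def by blast
      have "enat N \<le> v (fps_nth (s m) i - fps_nth (s n) i)" if "m \<ge> M" "n \<ge> M" for m n
      proof -
        have "enat (N + i) \<le> v (fps_nth (s m - s n) i) + enat i"
          using M that series_filtration_le order_trans by blast
        then show ?thesis by (cases "v (fps_nth (s m - s n) i)") auto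
      qed
      then show ?thesis by blast
    qed
    then show ?thesis
      using complete[unfolded filt_complete_def filt_Cauchy_def, rule_format, of "\<lambda>n. fps_nth (s n) i"]
      by blast
  qed
  then obtain l where l: "\<And>i. filt_tendsto v (\<lambda>n. fps_nth (s n) i) (l i)" by metis
  have "\<exists>M. \<forall>m\<ge>M. enat N \<le> f (s m - Abs_fps l)" for N
  proof -
    obtain M where M: "\<forall>m\<ge>M. \<forall>n\<ge>M. enat N \<le> f (s m - s n)"
      using s unfolding filt_Cauchy_def by blast
    have "enat N \<le> v (fps_nth (s m - Abs_fps l) i) + enat i" if "m \<ge> M" for m i
    proof -
      obtain M' where M': "\<forall>n\<ge>M'. enat N \<le> v (fps_nth (s n) i - l i)"
        using l[of i] unfolding filt_tendsto_def by blast
      \<comment> \<open>The comparison index \<open>n\<close> may depend on \<open>i\<close> through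
        \<open>M'\<close>, while \<open>M\<close> does not; this gives uniformity.\<close>
      define n where "n = max M M'"
      have "enat N \<le> v (fps_nth (s m - s n) i) + enat i"
        using M that series_filtration_le order_trans unfolding n_def by (meson max.cobounded1)
      moreover have "enat N \<le> v (fps_nth (s n) i - l i)"
        using M' by (simp add: n_def)
      then have "enat N \<le> v (fps_nth (s n) i - l i) + enat i"
        by (metis add_increasing2 zero_le)
      ultimately have "enat N \<le> min (v (fps_nth (s m - s n) i)) (v (fps_nth (s n) i - l i)) + enat i"
        by (auto simp: min_def)
      also have "\<dots> \<le> v (fps_nth (s m - s n) i + (fps_nth (s n) i - l i)) + enat i"
        by (intro add_right_mono filt_add)
      finally show ?thesis by simp
    qed
    then show ?thesis by (auto simp: series_filtration_ge_iff)
  qed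
  then show "\<exists>l. filt_tendsto f s l" unfolding filt_tendsto_def by blast
qed

lemma filt_sums_nth:
  assumes "filt_sums f g p"
  shows "filt_sums v (\<lambda>i. fps_nth (g i) n) (fps_nth p n)"
  by (rule filt_sums_image[where T = "\<lambda>p. fps_nth p n" and w = f and k = n,
        OF _ series_filtration_le assms]) (simp add: additive_def)

text \<open>The remainder after \<open>n\<close> terms has no coefficients below degree
  \<open>n\<close>. The library product only puts coefficients in their places here.\<close>

lemma filt_sums_monomials: "filt_sums f (\<lambda>i. fps_const (fps_nth p i) * fps_X ^ i) p"
proof -
  have nth: "fps_nth (\<Sum>i<n. fps_const (fps_nth p i) * fps_X ^ i) k = (if k < n then fps_nth p k else 0)"
    for n k
  proof -
    have "(\<Sum>i<n. fps_nth p i * (if k = i then 1 else 0)) = (\<Sum>i<n. if k = i then fps_nth p i else 0)"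
      by (intro sum.cong) auto
    then show ?thesis by (simp add: fps_sum_nth fps_X_power_nth)
  qed
  have "enat N \<le> f ((\<Sum>i<n. fps_const (fps_nth p i) * fps_X ^ i) - p)" if "n \<ge> N" for N n
    using that unfolding series_filtration_ge_iff
    by (auto simp: nth fps_sub_nth add_increasing)
  then show ?thesis unfolding filt_sums_def filt_tendsto_def by blast
qed

end

section \<open>Power series in an operator\<close>

lemma additive_funpow:
  fixes Y :: "'b::ab_group_add \<Rightarrow> 'b"
  shows "additive Y \<Longrightarrow> additive (Y ^^ i)"
  unfolding additive_def by (induction i) simp_all

context complete_filtered_ring
begin

text \<open>A gain of one per application makes a series in \<open>Y\<close> converge for every
  choice of coefficients.\<close>

definition raising :: "('a fps \<Rightarrow> 'a fps) \<Rightarrow> bool" where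
  "raising Y \<longleftrightarrow> additive Y \<and> (\<forall>p. f p + 1 \<le> f (Y p))"

text \<open>With \<open>Y\<close> the left multiplication by the variable this is the skew product
  of \<open>c\<close> and \<open>m\<close>; with \<open>Y\<close> the left multiplication by
  \<open>y\<close> and \<open>m = 1\<close> it is the substitution of \<open>y\<close> into
  \<open>c\<close>.\<close>

definition op_series :: "('a fps \<Rightarrow> 'a fps) \<Rightarrow> 'a fps \<Rightarrow> 'a fps \<Rightarrow> 'a fps" where
  "op_series Y c m = filt_suminf f (\<lambda>i. fps_const (fps_nth c i) * (Y ^^ i) m)"

lemma raising_additive: "raising Y \<Longrightarrow> additive Y"
  by (simp add: raising_def)

lemma raising_funpow: "raising Y \<Longrightarrow> f p + enat i \<le> f ((Y ^^ i) p)"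
proof (induction i)
  case (Suc i)
  then have "f p + enat i + 1 \<le> f ((Y ^^ i) p) + 1" by (intro add_right_mono)
  also have "\<dots> \<le> f ((Y ^^ Suc i) p)" using Suc.prems by (simp add: raising_def)
  finally show ?case by (simp add: add.assoc one_enat_def)
qed (simp add: zero_enat_def[symmetric])

text \<open>The \<open>i\<close> gained by \<open>Y ^^ i\<close> is exactly the weight that
  \<open>f c\<close> gives to the coefficient of index \<open>i\<close>. The first bound passes to
  the sum, the second yields convergence.\<close>

lemma op_series_term_ge:
  assumes "raising Y"
  shows "f c + f m \<le> f (fps_const (fps_nth c i) * (Y ^^ i) m)"
    and "enat i \<le> f (fps_const (fps_nth c i) * (Y ^^ i) m)"
proof -
  have "v (fps_nth c i) + (f m + enat i) \<le> v (fps_nth c i) + f ((Y ^^ i) m)"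
    by (intro add_left_mono raising_funpow assms)
  also have "\<dots> \<le> f (fps_const (fps_nth c i) * (Y ^^ i) m)"
    by (rule series_filtration_const_mult)
  finally have *: "v (fps_nth c i) + (f m + enat i) \<le> f (fps_const (fps_nth c i) * (Y ^^ i) m)" .
  have "f c + f m \<le> (v (fps_nth c i) + enat i) + f m"
    by (intro add_right_mono series_filtration_le)
  also have "\<dots> = v (fps_nth c i) + (f m + enat i)"
    by (simp add: ac_simps)
  also note *
  finally show "f c + f m \<le> f (fps_const (fps_nth c i) * (Y ^^ i) m)" .
  have "enat i \<le> v (fps_nth c i) + (f m + enat i)"
    by (simp add: add_increasing)
  with * show "enat i \<le> f (fps_const (fps_nth c i) * (Y ^^ i) m)"
    by (rule order_trans[rotated])
qed

lemma op_series_sums: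
  assumes "raising Y"
  shows "filt_sums f (\<lambda>i. fps_const (fps_nth c i) * (Y ^^ i) m) (op_series Y c m)"
proof -
  obtain l where "filt_sums f (\<lambda>i. fps_const (fps_nth c i) * (Y ^^ i) m) l"
    using series.filt_summable[OF filt_complete_series op_series_term_ge(2)[OF assms, of _ c m]] by blast
  then show ?thesis by (simp add: op_series_def series.filt_suminf_eq)
qed

lemma op_series_eqI:
  assumes "filt_sums f (\<lambda>i. fps_const (fps_nth c i) * (Y ^^ i) m) l"
  shows "op_series Y c m = l"
  using assms by (simp add: op_series_def series.filt_suminf_eq)

lemma op_series_ge: "raising Y \<Longrightarrow> f c + f m \<le> f (op_series Y c m)"
  by (rule series.filt_sums_ge[OF op_series_sums op_series_term_ge(1)])

lemma op_series_add_left: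
  assumes "raising Y"
  shows "op_series Y (c + d) m = op_series Y c m + op_series Y d m"
  using series.filt_sums_add[OF op_series_sums[OF assms] op_series_sums[OF assms]]
  by (intro op_series_eqI) (simp add: fps_const_add[symmetric] distrib_right del: fps_const_add)

lemma op_series_add_right:
  assumes "raising Y"
  shows "op_series Y c (m + n) = op_series Y c m + op_series Y c n"
  using series.filt_sums_add[OF op_series_sums[OF assms] op_series_sums[OF assms]]
  by (intro op_series_eqI)
    (simp add: additive.add[OF additive_funpow[OF raising_additive[OF assms]]] distrib_left)

lemma op_series_const_mult:
  assumes "raising Y"
  shows "op_series Y (fps_const r * c) m = fps_const r * op_series Y c m"
proof (rule op_series_eqI)
  have "filt_sums f (\<lambda>i. fps_const r * (fps_const (fps_nth c i) * (Y ^^ i) m))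
      (fps_const r * op_series Y c m)"
    by (rule filt_sums_image[where T = "\<lambda>p. fps_const r * p" and w = f and k = 0,
          OF _ series_filtration_const_mult' op_series_sums[OF assms]])
      (simp add: additive_def distrib_left)
  then show "filt_sums f (\<lambda>i. fps_const (fps_nth (fps_const r * c) i) * (Y ^^ i) m)
      (fps_const r * op_series Y c m)"
    by (simp add: fps_const_mult[symmetric] mult.assoc del: fps_const_mult)
qed

lemma op_series_const: "op_series Y (fps_const r) m = fps_const r * m"
proof (rule op_series_eqI)
  show "filt_sums f (\<lambda>i. fps_const (fps_nth (fps_const r) i) * (Y ^^ i) m) (fps_const r * m)"
    using series.filt_sums_finite[of 1 "\<lambda>i. fps_const (fps_nth (fps_const r) i) * (Y ^^ i) m"]
    by simp
qed

lemma op_series_X: "op_series Y fps_X m = Y m"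
proof (rule op_series_eqI)
  show "filt_sums f (\<lambda>i. fps_const (fps_nth fps_X i) * (Y ^^ i) m) (Y m)"
    using series.filt_sums_finite[of 2 "\<lambda>i. fps_const (fps_nth fps_X i) * (Y ^^ i) m"]
    by (simp add: numeral_2_eq_2)
qed

end

section \<open>The skew power series ring\<close>

text \<open>Left multiplication by the variable, read off from
  \<open>x r = \<sigma>(r) x + \<delta>(r)\<close> on each coefficient. It is introduced
  independently of the product, whose associativity is derived from it.\<close>

definition skew_shift :: "('a::ring_1 \<Rightarrow> 'a) \<Rightarrow> ('a \<Rightarrow> 'a) \<Rightarrow> 'a fps \<Rightarrow> 'a fps" where
  "skew_shift \<sigma> \<delta> p =
     Abs_fps (\<lambda>n. (case n of 0 \<Rightarrow> 0 | Suc k \<Rightarrow> \<sigma> (fps_nth p k)) + \<delta> (fps_nth p n))"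

definition semilinear :: "('a::ring_1 \<Rightarrow> 'a) \<Rightarrow> ('a \<Rightarrow> 'a) \<Rightarrow> ('a fps \<Rightarrow> 'a fps) \<Rightarrow> bool" where
  "semilinear \<sigma> \<delta> Y \<longleftrightarrow>
     (\<forall>r m. Y (fps_const r * m) = fps_const (\<sigma> r) * Y m + fps_const (\<delta> r) * m)"

locale skew_power_series = complete_filtered_ring +
  fixes \<sigma> \<delta> :: "'a \<Rightarrow> 'a"
  assumes skew_derivation: "skew_derivation \<sigma> \<delta>" and compatible: "compatible v \<sigma> \<delta>"
begin

abbreviation X where "X \<equiv> skew_shift \<sigma> \<delta>"
abbreviation mult (infixl "\<star>" 70) where "p \<star> q \<equiv> skew_mult v \<sigma> \<delta> p q"

lemma additive_auto: "additive \<sigma>" and additive_deriv: "additive \<delta>"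
  and auto_mult: "\<sigma> (r * s) = \<sigma> r * \<sigma> s" and auto_one [simp]: "\<sigma> 1 = 1"
  and deriv_mult: "\<delta> (r * s) = \<delta> r * s + \<sigma> r * \<delta> s"
  using skew_derivation unfolding skew_derivation_def ring_automorphism_def additive_def by blast+

lemmas auto_zero [simp] = additive.zero[OF additive_auto]
  and deriv_zero [simp] = additive.zero[OF additive_deriv]

lemma deriv_one [simp]: "\<delta> 1 = 0"
  using deriv_mult[of 1 1] by simp

lemma filt_auto: "v (\<sigma> r) = v r"
  using compatible unfolding compatible_def by (cases "r = 0") auto

text \<open>A strict inequality in \<open>enat\<close> is a gain of at least one. At
  \<open>r = 0\<close>, where compatibility is silent, both sides are infinite.\<close>

lemma filt_deriv: "v r + 1 \<le> v (\<delta> r)"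
  using compatible ileI1[of "v r" "v (\<delta> r)"] unfolding compatible_def
  by (cases "r = 0") (auto simp: eSuc_plus_1)

text \<open>The \<open>\<sigma>\<close> part gains one in degree, the \<open>\<delta>\<close> part
  gains one in \<open>v\<close>.\<close>

lemma raising_shift: "raising X"
  unfolding raising_def
proof
  show "additive X"
    by (auto simp: additive_def skew_shift_def fps_eq_iff additive.add[OF additive_auto]
        additive.add[OF additive_deriv] split: nat.splits)
  show "\<forall>p. f p + 1 \<le> f (X p)"
  proof
    fix p
    have "f p + 1 \<le> v (fps_nth (X p) n) + enat n" for n
    proof -
      define A where "A = (case n of 0 \<Rightarrow> 0 | Suc k \<Rightarrow> \<sigma> (fps_nth p k))"
      have "f p + 1 \<le> v A + enat n"
      proof (cases n)
        case (Suc k)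
        have "f p + 1 \<le> v (fps_nth p k) + enat k + 1"
          by (intro add_right_mono series_filtration_le)
        then show ?thesis by (simp add: A_def Suc filt_auto add.assoc one_enat_def)
      qed (simp add: A_def)
      moreover have "f p + 1 \<le> v (\<delta> (fps_nth p n)) + enat n"
      proof -
        have "f p + 1 \<le> v (fps_nth p n) + enat n + 1"
          by (intro add_right_mono series_filtration_le)
        also have "\<dots> = (v (fps_nth p n) + 1) + enat n"
          by (simp add: ac_simps)
        also have "\<dots> \<le> v (\<delta> (fps_nth p n)) + enat n"
          by (intro add_right_mono filt_deriv)
        finally show ?thesis .
      qed
      ultimately have "f p + 1 \<le> min (v A) (v (\<delta> (fps_nth p n))) + enat n"
        by (auto simp: min_def)
      also have "\<dots> \<le> v (A + \<delta> (fps_nth p n)) + enat n"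
        by (intro add_right_mono filt_add)
      finally show ?thesis by (simp add: A_def skew_shift_def)
    qed
    then show "f p + 1 \<le> f (X p)" by (simp add: series_filtration_ge_iff)
  qed
qed

text \<open>Coefficientwise this is multiplicativity of \<open>\<sigma>\<close> together with the
  twisted Leibniz rule for \<open>\<delta>\<close>.\<close>

lemma semilinear_shift: "semilinear \<sigma> \<delta> X"
  by (auto simp: semilinear_def skew_shift_def fps_eq_iff auto_mult deriv_mult algebra_simps
      split: nat.splits)

lemma funpow_shift_nth: "fps_nth ((X ^^ i) q) n = (\<Sum>j\<le>n. skew_coeff \<sigma> \<delta> i (n - j) (fps_nth q j))"
proof (induction i arbitrary: n)
  case 0
  have "(\<Sum>j\<le>n. if n - j = 0 then fps_nth q j else 0) = (\<Sum>j\<le>n. if j = n then fps_nth q j else 0)"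
    by (intro sum.cong) auto
  then show ?case by simp
next
  case (Suc i)
  let ?c = "\<lambda>n j. skew_coeff \<sigma> \<delta> i (n - j) (fps_nth q j)"
  \<comment> \<open>The range is extended from \<open>k\<close> to \<open>n = Suc k\<close>; the new
    term \<open>j = n\<close> is zero and matches the zero branch in
    \<open>skew_coeff\<close>.\<close>
  have "(case n of 0 \<Rightarrow> 0 | Suc k \<Rightarrow> \<sigma> (\<Sum>j\<le>k. ?c k j)) =
      (\<Sum>j\<le>n. if n - j = 0 then 0 else \<sigma> (skew_coeff \<sigma> \<delta> i (n - j - 1) (fps_nth q j)))"
    by (cases n) (auto simp: additive.sum[OF additive_auto] Suc_diff_le intro!: sum.cong)
  then show ?case
    by (simp add: skew_shift_def[of _ _ "(X ^^ i) q"] Suc.IH cong: nat.case_cong add: additive.sum[OF additive_deriv] sum.distrib)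
qed

text \<open>Taking a coefficient is continuous, so the coefficientwise sums defining the product are
  the coefficients of one sum convergent for \<open>f\<close>.\<close>

lemma mult_eq_op_series: "p \<star> q = op_series X p q"
proof (rule fps_ext)
  fix n
  have "filt_sums v (\<lambda>i. fps_nth (fps_const (fps_nth p i) * (X ^^ i) q) n) (fps_nth (op_series X p q) n)"
    by (rule filt_sums_nth[OF op_series_sums[OF raising_shift]])
  then have "filt_suminf v (\<lambda>i. \<Sum>j\<le>n. fps_nth p i * skew_coeff \<sigma> \<delta> i (n - j) (fps_nth q j)) =
      fps_nth (op_series X p q) n"
    by (intro filt_suminf_eq) (simp add: funpow_shift_nth sum_distrib_left)
  then show "fps_nth (p \<star> q) n = fps_nth (op_series X p q) n"
    by (simp add: skew_mult_def)
qed

text \<open>Semilinearity lets \<open>Y\<close> pass through a series in \<open>Y\<close> by acting on its coefficients as left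
  multiplication by the variable; iterating this gives the associativity law below.\<close>

lemma op_series_shift:
  assumes Y: "raising Y" and semi: "semilinear \<sigma> \<delta> Y"
  shows "op_series Y (X d) m = Y (op_series Y d m)"
proof (rule op_series_eqI)
  have bound: "f p \<le> f (Y p) + enat 0" for p
    using order_trans[OF add_increasing2[OF zero_le order_refl], of "f p" 1 "f (Y p)"] Y
    by (simp add: raising_def zero_enat_def[symmetric])
  let ?s = "\<lambda>i. fps_const (\<sigma> (fps_nth d i)) * Y ((Y ^^ i) m)"
  let ?t = "\<lambda>i. fps_const (\<delta> (fps_nth d i)) * (Y ^^ i) m"
  \<comment> \<open>Based at \<open>Y m\<close>, since
    \<open>Y ((Y ^^ i) m) = (Y ^^ i) (Y m)\<close>.\<close>
  let ?S = "op_series Y (Abs_fps (\<lambda>i. \<sigma> (fps_nth d i))) (Y m)"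
  let ?T = "op_series Y (Abs_fps (\<lambda>i. \<delta> (fps_nth d i))) m"
  have s: "filt_sums f ?s ?S" and t: "filt_sums f ?t ?T"
    using op_series_sums[OF Y, of "Abs_fps (\<lambda>i. \<sigma> (fps_nth d i))" "Y m"]
      op_series_sums[OF Y, of "Abs_fps (\<lambda>i. \<delta> (fps_nth d i))" m]
    by (simp_all add: funpow_swap1)
  have "filt_sums f (\<lambda>i. Y (fps_const (fps_nth d i) * (Y ^^ i) m)) (Y (op_series Y d m))"
    by (rule filt_sums_image[where T = Y and w = f and k = 0,
          OF raising_additive[OF Y] bound op_series_sums[OF Y]])
  then have "filt_sums f (\<lambda>i. ?s i + ?t i) (Y (op_series Y d m))"
    using semi by (simp add: semilinear_def)
  then have eq: "Y (op_series Y d m) = ?S + ?T"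
    using series.filt_sums_unique series.filt_sums_add[OF s t] by blast
  \<comment> \<open>Shifting the \<open>\<sigma>\<close> terms by one index collects equal powers of
    \<open>Y\<close>; the combined coefficients are those of \<open>X d\<close>.\<close>
  have "filt_sums f (\<lambda>i. (case i of 0 \<Rightarrow> 0 | Suc j \<Rightarrow> ?s j) + ?t i) (?S + ?T)"
    by (intro series.filt_sums_add series.filt_sums_shift s t)
  moreover have "(case i of 0 \<Rightarrow> 0 | Suc j \<Rightarrow> ?s j) + ?t i = fps_const (fps_nth (X d) i) * (Y ^^ i) m" for i
    by (cases i) (simp_all add: skew_shift_def fps_const_add[symmetric] distrib_right del: fps_const_add)
  ultimately show "filt_sums f (\<lambda>i. fps_const (fps_nth (X d) i) * (Y ^^ i) m) (Y (op_series Y d m))"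
    by (simp only: eq)
qed

lemma op_series_assoc:
  assumes Y: "raising Y" and semi: "semilinear \<sigma> \<delta> Y"
  shows "op_series Y (c \<star> d) m = op_series Y c (op_series Y d m)"
proof -
  have pow: "op_series Y ((X ^^ i) d) m = (Y ^^ i) (op_series Y d m)" for i
    by (induction i) (simp_all add: op_series_shift[OF assms])
  \<comment> \<open>The product is the sum of the terms \<open>c_i (X ^^ i) d\<close>, and
    evaluation on \<open>m\<close>, being additive and not lowering \<open>f\<close>, passes through
    this sum.\<close>
  have *: "filt_sums f (\<lambda>i. op_series Y (fps_const (fps_nth c i) * (X ^^ i) d) m)
      (op_series Y (c \<star> d) m)"
    unfolding mult_eq_op_series
  proof (rule filt_sums_image[where T = "\<lambda>e. op_series Y e m" and w = f and k = 0,
        OF _ _ op_series_sums[OF raising_shift]])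
    show "additive (\<lambda>e. op_series Y e m)"
      by (simp add: additive_def op_series_add_left[OF Y])
    show "f e \<le> f (op_series Y e m) + enat 0" for e
      using op_series_ge[OF Y, of e m] by (auto simp: zero_enat_def[symmetric] intro: order_trans[rotated])
  qed
  show ?thesis
    using * by (intro op_series_eqI[symmetric]) (simp add: op_series_const_mult[OF Y] pow)
qed

lemma mult_assoc: "(p \<star> q) \<star> r = p \<star> (q \<star> r)"
  using op_series_assoc[OF raising_shift semilinear_shift] by (simp add: mult_eq_op_series)

lemma mult_add_left: "(p + q) \<star> r = p \<star> r + q \<star> r"
  and mult_add_right: "p \<star> (q + r) = p \<star> q + p \<star> r"
  and mult_ge: "f p + f q \<le> f (p \<star> q)"
  by (simp_all add: mult_eq_op_series op_series_add_left op_series_add_right op_series_ge raising_shift)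

lemma const_mult: "fps_const r \<star> p = fps_const r * p"
  by (rule skew_mult_const_left[OF positive_filtration])

lemma const_mult_mult: "(fps_const r * p) \<star> q = fps_const r * (p \<star> q)"
  by (simp add: mult_eq_op_series op_series_const_mult raising_shift)

lemma X_mult: "fps_X \<star> p = X p"
  by (simp add: mult_eq_op_series op_series_X)

text \<open>As \<open>\<sigma> 1 = 1\<close> and \<open>\<delta> 1 = 0\<close>, the iterates of
  \<open>X\<close> at \<open>1\<close> are the monomials, and the product is the monomial expansion
  of \<open>p\<close>.\<close>

lemma mult_one: "p \<star> 1 = p"
  unfolding mult_eq_op_series
proof (rule op_series_eqI)
  have "X (fps_X ^ i) = fps_X ^ Suc i" for i
    unfolding fps_eq_iff skew_shift_def fps_X_power_nth by (auto split: nat.splits)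
  then have "(X ^^ i) 1 = fps_X ^ i" for i
    by (induction i) simp_all
  then show "filt_sums f (\<lambda>i. fps_const (fps_nth p i) * (X ^^ i) 1) p"
    using filt_sums_monomials by simp
qed

section \<open>Change of variable\<close>

text \<open>The bound makes left multiplication by \<open>y\<close> raising, the relation makes it
  semilinear.\<close>

definition skew_variable :: "'a fps \<Rightarrow> ('a \<Rightarrow> 'a) \<Rightarrow> ('a \<Rightarrow> 'a) \<Rightarrow> bool" where
  "skew_variable y \<sigma>' \<delta>' \<longleftrightarrow> 1 \<le> f y \<and>
     (\<forall>r. y \<star> fps_const r = fps_const (\<sigma>' r) \<star> y + fps_const (\<delta>' r))"

lemma raising_mult:
  assumes "1 \<le> f y"
  shows "raising (mult y)"
  unfolding raising_def
proof (intro conjI allI)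
  fix p
  have "f p + 1 \<le> f y + f p" using assms by (simp add: add.commute add_right_mono)
  also have "\<dots> \<le> f (y \<star> p)" by (rule mult_ge)
  finally show "f p + 1 \<le> f (y \<star> p)" .
qed (simp add: additive_def mult_add_right)

lemma semilinear_mult:
  assumes "skew_variable y \<sigma>' \<delta>'"
  shows "semilinear \<sigma>' \<delta>' (mult y)"
  unfolding semilinear_def
proof (intro allI)
  fix r m
  have "y \<star> (fps_const r * m) = (y \<star> fps_const r) \<star> m"
    by (simp add: mult_assoc const_mult)
  then show "y \<star> (fps_const r * m) = fps_const (\<sigma>' r) * (y \<star> m) + fps_const (\<delta>' r) * m"
    using assms by (simp add: skew_variable_def mult_add_left const_mult const_mult_mult)
qed

lemma skew_power_eq: "skew_power v \<sigma> \<delta> y i = (mult y ^^ i) 1"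
  by (induction i) simp_all

text \<open>Series in \<open>y\<close> always converge and limits are unique, so the expansion
  relation is the graph of a map.\<close>

lemma skew_expansion_iff:
  assumes "1 \<le> f y"
  shows "skew_expansion v \<sigma> \<delta> y c p \<longleftrightarrow> p = op_series (mult y) c 1"
proof -
  have "skew_expansion v \<sigma> \<delta> y c p \<longleftrightarrow> filt_sums f (\<lambda>i. fps_const (fps_nth c i) * (mult y ^^ i) 1) p"
    by (simp add: skew_expansion_def skew_power_eq const_mult)
  then show ?thesis
    using op_series_sums[OF raising_mult[OF assms]] op_series_eqI by metis
qed

text \<open>Right multiplication by \<open>q\<close> is continuous and, by associativity, commutes
  with left multiplication by \<open>y\<close>.\<close>

lemma op_series_mult_distrib:
  assumes "1 \<le> f y"
  shows "op_series (mult y) c p \<star> q = op_series (mult y) c (p \<star> q)"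
proof (rule op_series_eqI[symmetric])
  have *: "(mult y ^^ i) p \<star> q = (mult y ^^ i) (p \<star> q)" for i
    by (induction i) (simp_all add: mult_assoc)
  have "filt_sums f (\<lambda>i. (fps_const (fps_nth c i) * (mult y ^^ i) p) \<star> q) (op_series (mult y) c p \<star> q)"
  proof (rule filt_sums_image[where T = "\<lambda>e. e \<star> q" and w = f and k = 0,
        OF _ _ op_series_sums[OF raising_mult[OF assms]]])
    show "additive (\<lambda>e. e \<star> q)" by (simp add: additive_def mult_add_left)
    show "f e \<le> f (e \<star> q) + enat 0" for e
      using mult_ge[of e q] by (auto simp: zero_enat_def[symmetric] intro: order_trans[rotated])
  qed
  then show "filt_sums f (\<lambda>i. fps_const (fps_nth c i) * (mult y ^^ i) (p \<star> q)) (op_series (mult y) c p \<star> q)"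
    by (simp add: const_mult_mult *)
qed

end

section \<open>Substitution of the new variable and its inverse\<close>

lemma evaluation_mult:
  assumes "skew_power_series v \<sigma> \<delta>" "skew_power_series v \<sigma>' \<delta>'"
    and "skew_power_series.skew_variable v \<sigma> \<delta> y \<sigma>' \<delta>'"
  defines "ev \<equiv> \<lambda>c. complete_filtered_ring.op_series v (skew_mult v \<sigma> \<delta> y) c 1"
  shows "ev (skew_mult v \<sigma>' \<delta>' c d) = skew_mult v \<sigma> \<delta> (ev c) (ev d)"
proof -
  interpret S: skew_power_series v \<sigma> \<delta> by fact
  interpret S': skew_power_series v \<sigma>' \<delta>' by fact
  have y: "1 \<le> series_filtration v y" using assms(3) by (simp add: S.skew_variable_def)
  \<comment> \<open>The module law over the ring in the new variable, acting through left
    multiplication by \<open>y\<close>.\<close>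
  have "ev (skew_mult v \<sigma>' \<delta>' c d) = S.op_series (S.mult y) c (ev d)"
    unfolding ev_def by (rule S'.op_series_assoc[OF S.raising_mult[OF y] S.semilinear_mult[OF assms(3)]])
  \<comment> \<open>The inserted \<open>1\<close> lets \<open>ev d\<close> be pulled out of the
    series as a right factor.\<close>
  also have "ev d = S.mult 1 (ev d)"
    using S.const_mult[of 1 "ev d"] by simp
  finally show ?thesis
    by (simp add: ev_def S.op_series_mult_distrib[OF y])
qed

text \<open>Substitution of \<open>y\<close> is multiplicative and sends \<open>y'\<close> to
  \<open>x\<close>, hence powers of \<open>y'\<close> to powers of \<open>x\<close>. By continuity
  it sends the series with coefficients \<open>p_i\<close> in \<open>y'\<close> to the one in
  \<open>x\<close>, which is \<open>p\<close>.\<close>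

lemma evaluation_inverse:
  assumes "skew_power_series v \<sigma> \<delta>" "skew_power_series v \<sigma>' \<delta>'"
    and y: "skew_power_series.skew_variable v \<sigma> \<delta> y \<sigma>' \<delta>'"
    and y': "1 \<le> series_filtration v y'"
    and inv: "complete_filtered_ring.op_series v (skew_mult v \<sigma> \<delta> y) y' 1 = fps_X"
  shows "complete_filtered_ring.op_series v (skew_mult v \<sigma> \<delta> y)
           (complete_filtered_ring.op_series v (skew_mult v \<sigma>' \<delta>' y') p 1) 1 = p"
proof -
  interpret S: skew_power_series v \<sigma> \<delta> by fact
  interpret S': skew_power_series v \<sigma>' \<delta>' by fact
  have y1: "1 \<le> series_filtration v y" using y by (simp add: S.skew_variable_def)
  note R = S.raising_mult[OF y1]
  define ev where "ev c = S.op_series (S.mult y) c 1" for c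
  note ev_mult = evaluation_mult[OF assms(1,2) y, folded ev_def]
  have "ev 1 = 1" using S.op_series_const[of "S.mult y" 1 1] by (simp add: ev_def)
  then have pow: "ev ((S'.mult y' ^^ i) 1) = (S.X ^^ i) 1" for i
    using inv by (induction i) (simp_all add: ev_mult S.X_mult ev_def[symmetric])
  have "filt_sums S.f (\<lambda>i. ev (fps_const (fps_nth p i) * (S'.mult y' ^^ i) 1))
      (ev (S.op_series (S'.mult y') p 1))"
  proof (rule filt_sums_image[where T = "ev" and w = "S.f" and k = 0,
        OF _ _ S.op_series_sums[OF S'.raising_mult[OF y']]])
    show "additive ev" by (simp add: ev_def additive_def S.op_series_add_left[OF R])
    show "S.f e \<le> S.f (ev e) + enat 0" for e
      using S.op_series_ge[OF R, of e 1] by (simp add: ev_def zero_enat_def[symmetric])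
  qed
  then have "filt_sums S.f (\<lambda>i. fps_const (fps_nth p i) * (S.X ^^ i) 1) (ev (S.op_series (S'.mult y') p 1))"
    using pow by (simp add: ev_def S.op_series_const_mult[OF R])
  then have "ev (S.op_series (S'.mult y') p 1) = S.mult p 1"
    using S.op_series_eqI by (simp add: S.mult_eq_op_series)
  then show ?thesis by (simp add: ev_def S.mult_one)
qed

text \<open>The situation is symmetric, so the two substitutions are inverse to each other. Neither
  lowers the filtration, hence both preserve it.\<close>

lemma skew_series_filtered_eqI:
  assumes "skew_power_series v \<sigma> \<delta>" "skew_power_series v \<sigma>' \<delta>'"
    and y: "skew_power_series.skew_variable v \<sigma> \<delta> y \<sigma>' \<delta>'"
    and y': "skew_power_series.skew_variable v \<sigma>' \<delta>' y' \<sigma> \<delta>"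
    and inv: "complete_filtered_ring.op_series v (skew_mult v \<sigma> \<delta> y) y' 1 = fps_X"
    and inv': "complete_filtered_ring.op_series v (skew_mult v \<sigma>' \<delta>' y') y 1 = fps_X"
  shows "skew_series_filtered_eq v \<sigma> \<delta> y \<sigma>' \<delta>'"
proof -
  interpret S: skew_power_series v \<sigma> \<delta> by fact
  interpret S': skew_power_series v \<sigma>' \<delta>' by fact
  have y1: "1 \<le> series_filtration v y" and rel: "S.mult y (fps_const r) = S.mult (fps_const (\<sigma>' r)) y + fps_const (\<delta>' r)" for r
    using y by (simp_all add: S.skew_variable_def)
  have y1': "1 \<le> series_filtration v y'" using y' by (simp add: S'.skew_variable_def)
  note R = S.raising_mult[OF y1] and R' = S'.raising_mult[OF y1']
  define ev where "ev c = S.op_series (S.mult y) c 1" for c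
  define ev' where "ev' c = S.op_series (S'.mult y') c 1" for c
  have ev_ev': "ev (ev' p) = p" and ev'_ev: "ev' (ev p) = p" for p
    using evaluation_inverse[OF assms(1,2) y y1' inv] evaluation_inverse[OF assms(2,1) y' y1 inv']
    by (simp_all add: ev_def ev'_def)
  have exp: "skew_expansion v \<sigma> \<delta> y c p \<longleftrightarrow> p = ev c" for c p
    by (simp add: S.skew_expansion_iff[OF y1] ev_def)
  have "\<exists>!c. p = ev c" for p
    by (metis ev_ev' ev'_ev)
  moreover have "ev 1 = 1" using S.op_series_const[of "S.mult y" 1 1] by (simp add: ev_def)
  moreover have "ev (c + d) = ev c + ev d" for c d
    by (simp add: ev_def S.op_series_add_left[OF R])
  moreover have "ev (S'.mult c d) = S.mult (ev c) (ev d)" for c d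
    using evaluation_mult[OF assms(1,2) y] by (simp add: ev_def)
  moreover have "S.f (ev c) = S.f c" for c
  proof (rule antisym)
    show "S.f c \<le> S.f (ev c)" using S.op_series_ge[OF R, of c 1] by (simp add: ev_def)
    show "S.f (ev c) \<le> S.f c"
      using S.op_series_ge[OF R', of "ev c" 1] ev'_ev[of c] by (simp add: ev'_def)
  qed
  ultimately show ?thesis
    unfolding skew_series_filtered_eq_def exp
    using S'.skew_derivation S'.compatible rel by simp
qed

section \<open>The substitutions \<open>x - t\<close> and \<open>ax\<close>\<close>

context skew_power_series
begin

lemma series_filtration_const_ge: "v r \<le> f (fps_const r)"
  using series_filtration_const_mult[of r 1] by simp

lemma series_filtration_X_ge: "1 \<le> f fps_X"
  using raising_shift mult_one[of fps_X] X_mult[of 1] unfolding raising_def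
  by (metis add.left_neutral series_filtration_one)

text \<open>Here \<open>(x - t) r = \<sigma>(r) (x - t) + \<delta>(r) - (t r - \<sigma>(r)
  t)\<close>, and \<open>v t \<ge> 1\<close> makes each correction term exceed \<open>v r\<close> by
  at least one.\<close>

lemma translate:
  assumes t: "1 \<le> v t"
  defines "\<delta>' \<equiv> \<lambda>r. \<delta> r - inner_skew_derivation \<sigma> t r"
  shows "skew_power_series v \<sigma> \<delta>'" and "skew_variable (fps_X - fps_const t) \<sigma> \<delta>'"
proof -
  have "skew_derivation \<sigma> \<delta>'"
    using skew_derivation
    unfolding skew_derivation_def ring_automorphism_def \<delta>'_def inner_skew_derivation_def
    by (simp add: algebra_simps)
  moreover have "v r < v (\<delta>' r)" if "r \<noteq> 0" for r
  proof -
    have "v r + 1 \<le> v t + v r" "v r + 1 \<le> v (\<sigma> r) + v t"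
      using t by (simp_all add: filt_auto add.commute add_left_mono)
    then have "v r + 1 \<le> v (\<delta>' r)"
      unfolding \<delta>'_def inner_skew_derivation_def
      by (intro filt_diff_ge filt_deriv) (blast intro: order_trans filt_mult)+
    \<comment> \<open>Strictness needs \<open>v r\<close> finite, that is
      \<open>r \<noteq> 0\<close>.\<close>
    moreover have "v r < v r + 1"
      using that filt_eq_infinity_iff[of r] by (cases "v r") (auto simp: one_enat_def)
    ultimately show ?thesis by (rule less_le_trans[rotated])
  qed
  ultimately show "skew_power_series v \<sigma> \<delta>'"
    by unfold_locales (simp_all add: compatible_def filt_auto)
  have "1 \<le> f (fps_X - fps_const t)"
    using t series_filtration_const_ge[of t] series_filtration_X_ge
    by (intro series.filt_diff_ge) auto
  moreover have "(fps_X - fps_const t) \<star> fps_const r =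
      fps_const (\<sigma> r) \<star> (fps_X - fps_const t) + fps_const (\<delta>' r)" for r
  proof -
    have "additive (\<lambda>p. p \<star> fps_const r)" by (simp add: additive_def mult_add_left)
    then have "(fps_X - fps_const t) \<star> fps_const r = fps_X \<star> fps_const r - fps_const t \<star> fps_const r"
      by (rule additive.diff)
    then show ?thesis
      unfolding skew_mult_X_const[OF positive_filtration skew_derivation]
      by (simp add: const_mult \<delta>'_def inner_skew_derivation_def right_diff_distrib
          fps_const_sub[symmetric] del: fps_const_sub)
  qed
  ultimately show "skew_variable (fps_X - fps_const t) \<sigma> \<delta>'"
    by (simp add: skew_variable_def)
qed

text \<open>Inserting \<open>a' * a = 1\<close> gives
  \<open>a x r = (a \<sigma>(r) a') (a x) + a \<delta>(r)\<close>. Multiplication by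
  \<open>a\<close> or \<open>a'\<close> on either side does not lower \<open>v\<close>.\<close>

lemma rescale:
  assumes a: "v a = 0" "v a' = 0" "a * a' = 1" "a' * a = 1"
  shows "skew_power_series v (conj_by a a' \<circ> \<sigma>) (\<lambda>r. a * \<delta> r)"
    and "skew_variable (fps_const a * fps_X) (conj_by a a' \<circ> \<sigma>) (\<lambda>r. a * \<delta> r)"
proof -
  have cancel: "a' * (a * r) = r" "a * (a' * r) = r" for r
    using a by (simp_all add: mult.assoc[symmetric])
  have "bij \<sigma>"
    using skew_derivation unfolding skew_derivation_def ring_automorphism_def by blast
  moreover have "bij (conj_by a a')"
    by (rule o_bij[where g = "conj_by a' a"]) (auto simp: fun_eq_iff conj_by_def mult.assoc cancel a)
  ultimately have "ring_automorphism (conj_by a a' \<circ> \<sigma>)"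
    using a unfolding ring_automorphism_def
    by (auto simp: bij_comp conj_by_def additive.add[OF additive_auto] auto_mult mult.assoc cancel
        distrib_left distrib_right)
  then have "skew_derivation (conj_by a a' \<circ> \<sigma>) (\<lambda>r. a * \<delta> r)"
    unfolding skew_derivation_def
    by (simp add: conj_by_def additive.add[OF additive_deriv] deriv_mult mult.assoc cancel distrib_left)
  moreover have "v r \<le> v (a * r)" "v r \<le> v (a' * r)" "v r \<le> v (r * a)" "v r \<le> v (r * a')" for r
    using filt_mult[of a r] filt_mult[of a' r] filt_mult[of r a] filt_mult[of r a'] a by simp_all
  note ge = this
  have "v (conj_by a a' r) = v r" for r
  proof (rule antisym)
    \<comment> \<open>Conjugating back recovers \<open>r\<close>, again without lowering
      \<open>v\<close>.\<close>
    have "v (conj_by a a' r) \<le> v (a' * (conj_by a a' r) * a)"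
      using ge by (blast intro: order_trans)
    then show "v (conj_by a a' r) \<le> v r" by (simp add: conj_by_def mult.assoc cancel a)
    show "v r \<le> v (conj_by a a' r)"
      unfolding conj_by_def using ge by (blast intro: order_trans)
  qed
  moreover have "v r < v (a * \<delta> r)" if "r \<noteq> 0" for r
    using compatible that ge(1)[of "\<delta> r"] unfolding compatible_def by (auto intro: less_le_trans)
  ultimately show "skew_power_series v (conj_by a a' \<circ> \<sigma>) (\<lambda>r. a * \<delta> r)"
    by unfold_locales (simp_all add: compatible_def filt_auto)
  have "1 \<le> f (fps_const a * fps_X)"
    using series_filtration_X_ge series_filtration_const_mult[of a fps_X] a by (auto intro: order_trans)
  moreover have "(fps_const a * fps_X) \<star> fps_const r =
      fps_const ((conj_by a a' \<circ> \<sigma>) r) \<star> (fps_const a * fps_X) + fps_const (a * \<delta> r)" for r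
  proof -
    have "fps_const a * (fps_const (\<sigma> r) * fps_X) = fps_const (a * \<sigma> r * a') * (fps_const a * fps_X)"
      unfolding mult.assoc[symmetric] fps_const_mult by (simp add: mult.assoc a)
    then show ?thesis
      unfolding const_mult_mult skew_mult_X_const[OF positive_filtration skew_derivation]
      by (simp add: const_mult conj_by_def distrib_left)
  qed
  ultimately show "skew_variable (fps_const a * fps_X) (conj_by a a' \<circ> \<sigma>) (\<lambda>r. a * \<delta> r)"
    by (simp add: skew_variable_def)
qed

text \<open>With \<open>r = a'\<close> and \<open>y = ax\<close> the value is \<open>x\<close>;
  exchanging \<open>a\<close> and \<open>a'\<close> gives the opposite composite.\<close>

lemma evaluate_scaled_X:
  assumes "1 \<le> f y"
  shows "op_series (mult y) (fps_const r * fps_X) 1 = fps_const r * y"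
  by (simp add: op_series_const_mult[OF raising_mult[OF assms]] op_series_X mult_one)

text \<open>With \<open>r = - t\<close> and \<open>y = x - t\<close> the value is \<open>x\<close>;
  changing the sign of \<open>t\<close> gives the opposite composite.\<close>

lemma evaluate_translated_X:
  assumes "1 \<le> f y"
  shows "op_series (mult y) (fps_X - fps_const r) 1 = y - fps_const r"
proof -
  have "additive (\<lambda>c. op_series (mult y) c 1)"
    by (simp add: additive_def op_series_add_left[OF raising_mult[OF assms]])
  from additive.diff[OF this] show ?thesis
    by (simp add: op_series_X op_series_const mult_one)
qed

end

theorem theoremB:
  fixes v :: "'a::ring_1 \<Rightarrow> enat" and \<sigma> \<delta> :: "'a \<Rightarrow> 'a" and a a' t :: 'a
  assumes "positive_filtration v" and "filt_complete v"
    and "skew_derivation \<sigma> \<delta>" and "compatible v \<sigma> \<delta>"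
    and "a * a' = 1" and "a' * a = 1"
  shows "(v a = 0 \<and> v a' = 0 \<longrightarrow>
            skew_series_filtered_eq v \<sigma> \<delta> (skew_mult v \<sigma> \<delta> (fps_const a) fps_X)
              (conj_by a a' \<circ> \<sigma>) (\<lambda>r. a * \<delta> r)) \<and>
         (v t \<ge> 1 \<longrightarrow>
            skew_series_filtered_eq v \<sigma> \<delta> (fps_X - fps_const t)
              \<sigma> (\<lambda>r. \<delta> r - inner_skew_derivation \<sigma> t r))"
proof (intro conjI impI)
  interpret S: skew_power_series v \<sigma> \<delta>
    using assms by unfold_locales
  {
    assume a: "v a = 0 \<and> v a' = 0"
    note scaled = S.rescale[OF conjunct1[OF a] conjunct2[OF a] assms(5,6)]
    interpret S': skew_power_series v "conj_by a a' \<circ> \<sigma>" "\<lambda>r. a * \<delta> r"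
      by (rule scaled(1))
    \<comment> \<open>Rescaling by \<open>a'\<close> in the new ring returns to the original skew
      derivation.\<close>
    have "conj_by a' a \<circ> (conj_by a a' \<circ> \<sigma>) = \<sigma>" "(\<lambda>r. a' * (a * \<delta> r)) = \<delta>"
      using assms(5,6) by (simp_all add: fun_eq_iff conj_by_def mult.assoc)
        (simp_all add: mult.assoc[symmetric])
    then have scaled': "S'.skew_variable (fps_const a' * fps_X) \<sigma> \<delta>"
      using S'.rescale(2)[OF conjunct2[OF a] conjunct1[OF a] assms(6,5)] by simp
    have "skew_series_filtered_eq v \<sigma> \<delta> (fps_const a * fps_X) (conj_by a a' \<circ> \<sigma>) (\<lambda>r. a * \<delta> r)"
    proof (rule skew_series_filtered_eqI[OF S.skew_power_series_axioms scaled scaled'])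
      show "S.op_series (S.mult (fps_const a * fps_X)) (fps_const a' * fps_X) 1 = fps_X"
        using scaled(2) assms(6)
        by (simp add: S.skew_variable_def S.evaluate_scaled_X mult.assoc[symmetric])
      show "S.op_series (S'.mult (fps_const a' * fps_X)) (fps_const a * fps_X) 1 = fps_X"
        using scaled' assms(5)
        by (simp add: S'.skew_variable_def S'.evaluate_scaled_X mult.assoc[symmetric])
    qed
    then show "skew_series_filtered_eq v \<sigma> \<delta> (skew_mult v \<sigma> \<delta> (fps_const a) fps_X)
        (conj_by a a' \<circ> \<sigma>) (\<lambda>r. a * \<delta> r)"
      by (simp add: S.const_mult)
  next
    assume t: "v t \<ge> 1"
    note translated = S.translate[OF t]
    interpret S': skew_power_series v \<sigma> "\<lambda>r. \<delta> r - inner_skew_derivation \<sigma> t r"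
      by (rule translated(1))
    \<comment> \<open>Translation by \<open>- t\<close> undoes translation by \<open>t\<close>, as
      the inner part is additive in \<open>t\<close>.\<close>
    have "(\<lambda>r. \<delta> r - inner_skew_derivation \<sigma> t r - inner_skew_derivation \<sigma> (- t) r) = \<delta>"
      by (simp add: fun_eq_iff inner_skew_derivation_def)
    then have translated': "S'.skew_variable (fps_X - fps_const (- t)) \<sigma> \<delta>"
      using S'.translate(2)[of "- t"] t by simp
    show "skew_series_filtered_eq v \<sigma> \<delta> (fps_X - fps_const t)
        \<sigma> (\<lambda>r. \<delta> r - inner_skew_derivation \<sigma> t r)"
    proof (rule skew_series_filtered_eqI[OF S.skew_power_series_axioms translated translated'])
      show "S.op_series (S.mult (fps_X - fps_const t)) (fps_X - fps_const (- t)) 1 = fps_X"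
        using translated(2) unfolding S.skew_variable_def by (subst S.evaluate_translated_X) (simp_all add: fps_const_neg[symmetric] del: fps_const_neg)
      show "S.op_series (S'.mult (fps_X - fps_const (- t))) (fps_X - fps_const t) 1 = fps_X"
        using translated' unfolding S'.skew_variable_def by (subst S'.evaluate_translated_X) (simp_all add: fps_const_neg[symmetric] del: fps_const_neg)
    qed
  }
qed

end
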